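(* Let $f,g,\phi$ satisfy the composite smoothness assumption and the bounded domain assumption for some $\Omega\ge0$, and let the saddle-subdifferential operator $M=(\nabla_u\phi+\partial f,\,-\nabla_v\phi+\partial g)$ of the problem $\min_{u}\max_{v}\{f(u)+\phi(u,v)-g(v)\}$ satisfy the weak MVI condition for some $\rho\in\big[0,\frac{1}{2L+\hat L}\big)$. Then for $\tau\in\big(\frac{\rho}{1-\rho L},\frac{1}{L+\hat L}\big)$ the sequence $\{x_k\}$ of the SA-MGDA method with a finite number $J$ of inner iterations satisfies, for every $k\ge1$ and every $x_*\in X_*^\rho(M)$, $$\min_{i=1,\ldots,k}\ \min_{s_i\in MRx_{i-1}}\frac{\|s_i\|^2}{2\left(\frac1\tau+L\right)}\le\min_{i=1,\ldots,k}D_h(Rx_{i-1},x_{i-1})$$ $$\le\frac{D_h(x_*,x_0)}{\left(1-\rho\left(\frac1\tau+L\right)\right)k}+\frac{3\Omega^2\left(\frac1\tau+L\right)}{2\left(1-\rho\left(\frac1\tau+L\right)\right)}\exp\left(-\frac{\frac1\tau-2L_{vv}}{2\left(\frac1\tau+2L_{vv}\right)}J\right).$$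
   Context: Let $d=d_u+d_v$, $x=(u,v)\in\mathbb{R}^{d_u}\times\mathbb{R}^{d_v}=\mathbb{R}^d$ with Euclidean inner product and norm. Composite smoothness assumption: $f:\mathbb{R}^{d_u}\to(-\infty,\infty]$ and $g:\mathbb{R}^{d_v}\to(-\infty,\infty]$ are closed, proper and convex; $\phi:\mathbb{R}^d\to\mathbb{R}$ is continuously differentiable and there are $L_{uu},L_{uv},L_{vu},L_{vv}>0$ with $\|\nabla_u\phi(u,v)-\nabla_u\phi(\bar u,\bar v)\|\le L_{uu}\|u-\bar u\|+L_{uv}\|v-\bar v\|$ and $\|\nabla_v\phi(u,v)-\nabla_v\phi(\bar u,\bar v)\|\le L_{vu}\|u-\bar u\|+L_{vv}\|v-\bar v\|$ for all $u,\bar u,v,\bar v$. $L>0$ denotes a Lipschitz constant of $\nabla\phi$ (equivalently of $(\nabla_u\phi,-\nabla_v\phi)$) on $\mathbb{R}^d$, and $\hat L=\max\{L_{uu},L_{vv}\}$. Bounded domain assumption: $\|x-y\|\le\Omega$ for all $x,y\in\operatorname{dom}f\times\operatorname{dom}g$. $\operatorname{gra}M=\{(x,w):w\in Mx\}$; $X_*(M)=\{x_*:0\in Mx_*\}$ (assumed nonempty). Weak MVI condition with $\rho\ge0$: there exists $x_*\in X_*(M)$ such that $\langle x-x_*,w\rangle\ge-\frac\rho2\|w\|^2$ for all $(x,w)\in\operatorname{gra}M$. $X_*^\rho(M)$ is the set of all $x_*\in X_*(M)$ with this property. Let $h(u,v)=\frac{1}{2\tau}(\|u\|^2+\|v\|^2)-\phi(u,v)$,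 $D_h(x,y)=h(x)-h(y)-\langle\nabla h(y),x-y\rangle$, and let $R=(\nabla h+M)^{-1}\nabla h$ be the $h$-resolvent of $M$ ($y=Rx$ iff $\nabla h(x)-\nabla h(y)\in My$), which is single-valued on $\mathbb{R}^d$ for the given $\tau$. SA-MGDA with finite $J\ge1$: let $\eta=\frac{\tau}{1+2L_{vv}\tau}$ and $\operatorname{prox}_\psi=(I+\partial\psi)^{-1}$. From an initial point $x_0=(u_0,v_0)$, for $k=0,1,\dots$: set $u_{k+1}=\operatorname{prox}_{\tau f}[u_k-\tau\nabla_u\phi(u_k,v_k)]$ and $v_{k,0}=v_k$; for $j=0,\dots,J-1$ set $v_{k,j+1}=\operatorname{prox}_{\eta g}\big[\frac\eta\tau(v_k-\tau\nabla_v\phi(u_k,v_k))+2\eta L_{vv}\big(v_{k,j}+\frac1{L_{vv}}\nabla_v\phi(u_{k+1},v_{k,j})\big)\big]$; then $v_{k+1}=v_{k,J}$ and $x_{k+1}=(u_{k+1},v_{k+1})$. *)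

theory Defs
  imports "HOL-Analysis.Analysis"
begin

definition effdom :: "('a \<Rightarrow> ereal) \<Rightarrow> 'a set" where
  "effdom f = {x. f x < \<infinity>}"

definition epi :: "('a \<Rightarrow> ereal) \<Rightarrow> ('a \<times> real) set" where
  "epi f = {(x, t). f x \<le> ereal t}"

definition proper :: "('a \<Rightarrow> ereal) \<Rightarrow> bool" where
  "proper f \<longleftrightarrow> (\<forall>x. f x \<noteq> -\<infinity>) \<and> effdom f \<noteq> {}"

definition closed_proper_convex :: "('a::euclidean_space \<Rightarrow> ereal) \<Rightarrow> bool" where
  "closed_proper_convex f \<longleftrightarrow> closed (epi f) \<and> proper f \<and> convex (epi f)"

text \<open>For proper \<open>f\<close> this is empty at every point outside the effective domain.\<close>

definition subdiff :: "('a::euclidean_space \<Rightarrow> ereal) \<Rightarrow> 'a \<Rightarrow> 'a set" where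
  "subdiff f x = {p. \<forall>z. f x + ereal (p \<bullet> (z - x)) \<le> f z}"

text \<open>\<open>(I + \<partial>\<psi>)\<inverse>\<close>, which is single-valued for closed proper convex \<open>\<psi>\<close>.\<close>

definition prox :: "('a::euclidean_space \<Rightarrow> ereal) \<Rightarrow> 'a \<Rightarrow> 'a" where
  "prox \<psi> y = (THE p. y \<in> (\<lambda>w. p + w) ` subdiff \<psi> p)"

definition gradient :: "('a::real_inner \<Rightarrow> real) \<Rightarrow> 'a \<Rightarrow> 'a" where
  "gradient F x = (THE D. GDERIV F x :> D)"

definition grad_u :: "('a::real_inner \<times> 'b::real_inner \<Rightarrow> real) \<Rightarrow> 'a \<times> 'b \<Rightarrow> 'a" where
  "grad_u \<phi> x = gradient (\<lambda>u. \<phi> (u, snd x)) (fst x)"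

definition grad_v :: "('a::real_inner \<times> 'b::real_inner \<Rightarrow> real) \<Rightarrow> 'a \<times> 'b \<Rightarrow> 'b" where
  "grad_v \<phi> x = gradient (\<lambda>v. \<phi> (fst x, v)) (snd x)"

definition cont_diff :: "('a::real_inner \<Rightarrow> real) \<Rightarrow> bool" where
  "cont_diff F \<longleftrightarrow> (\<forall>x. \<exists>D. GDERIV F x :> D) \<and> continuous_on UNIV (gradient F)"

definition bregman :: "('a::real_inner \<Rightarrow> real) \<Rightarrow> 'a \<Rightarrow> 'a \<Rightarrow> real" where
  "bregman h x y = h x - h y - gradient h y \<bullet> (x - y)"

definition composite_smooth ::
  "('a::euclidean_space \<Rightarrow> ereal) \<Rightarrow> ('b::euclidean_space \<Rightarrow> ereal) \<Rightarrow> ('a \<times> 'b \<Rightarrow> real)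
    \<Rightarrow> real \<Rightarrow> real \<Rightarrow> real \<Rightarrow> real \<Rightarrow> bool" where
  "composite_smooth f g \<phi> Luu Luv Lvu Lvv \<longleftrightarrow>
     closed_proper_convex f \<and> closed_proper_convex g \<and> cont_diff \<phi> \<and>
     Luu > 0 \<and> Luv > 0 \<and> Lvu > 0 \<and> Lvv > 0 \<and>
     (\<forall>u u' v v'.
        norm (grad_u \<phi> (u, v) - grad_u \<phi> (u', v')) \<le> Luu * norm (u - u') + Luv * norm (v - v') \<and>
        norm (grad_v \<phi> (u, v) - grad_v \<phi> (u', v')) \<le> Lvu * norm (u - u') + Lvv * norm (v - v'))"

definition bounded_domain ::
  "('a::euclidean_space \<Rightarrow> ereal) \<Rightarrow> ('b::euclidean_space \<Rightarrow> ereal) \<Rightarrow> real \<Rightarrow> bool" where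
  "bounded_domain f g \<Omega> \<longleftrightarrow>
     (\<forall>x \<in> effdom f \<times> effdom g. \<forall>y \<in> effdom f \<times> effdom g. norm (x - y) \<le> \<Omega>)"

definition saddle_op ::
  "('a::euclidean_space \<Rightarrow> ereal) \<Rightarrow> ('b::euclidean_space \<Rightarrow> ereal) \<Rightarrow> ('a \<times> 'b \<Rightarrow> real)
    \<Rightarrow> 'a \<times> 'b \<Rightarrow> ('a \<times> 'b) set" where
  "saddle_op f g \<phi> x =
     ((\<lambda>p. grad_u \<phi> x + p) ` subdiff f (fst x)) \<times> ((\<lambda>q. - grad_v \<phi> x + q) ` subdiff g (snd x))"

definition gra :: "('a \<Rightarrow> 'a set) \<Rightarrow> ('a \<times> 'a) set" where
  "gra M = {(x, w). w \<in> M x}"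

definition zeros :: "('a::zero \<Rightarrow> 'a set) \<Rightarrow> 'a set" where
  "zeros M = {x. 0 \<in> M x}"

text \<open>The solutions \<open>X\<^sub>*\<^sup>\<rho>(M)\<close> at which the weak Minty inequality holds.\<close>

definition wmvi_zeros :: "real \<Rightarrow> ('a::real_inner \<Rightarrow> 'a set) \<Rightarrow> 'a set" where
  "wmvi_zeros \<rho> M =
     {xs \<in> zeros M. \<forall>(x, w) \<in> gra M. (x - xs) \<bullet> w \<ge> - (\<rho> / 2) * (norm w)\<^sup>2}"

definition weak_MVI :: "real \<Rightarrow> ('a::real_inner \<Rightarrow> 'a set) \<Rightarrow> bool" where
  "weak_MVI \<rho> M \<longleftrightarrow>
     (\<exists>xs \<in> zeros M. \<forall>(x, w) \<in> gra M. (x - xs) \<bullet> w \<ge> - (\<rho> / 2) * (norm w)\<^sup>2)"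

definition kernel_h :: "real \<Rightarrow> ('a::real_inner \<times> 'b::real_inner \<Rightarrow> real) \<Rightarrow> 'a \<times> 'b \<Rightarrow> real" where
  "kernel_h \<tau> \<phi> = (\<lambda>(u, v). 1 / (2 * \<tau>) * ((norm u)\<^sup>2 + (norm v)\<^sup>2) - \<phi> (u, v))"

text \<open>\<open>(\<nabla>h + M)\<inverse>\<nabla>h\<close>, as a function; meaningful only where this operator is single-valued.\<close>

definition h_resolvent :: "('a::real_inner \<Rightarrow> real) \<Rightarrow> ('a \<Rightarrow> 'a set) \<Rightarrow> 'a \<Rightarrow> 'a" where
  "h_resolvent h M x = (THE y. gradient h x \<in> (\<lambda>w. gradient h y + w) ` M y)"

text \<open>Inner iterates \<open>v\<^bsub>k,j\<^esub>\<close>, for \<open>(u, v) = (u\<^sub>k, v\<^sub>k)\<close> and \<open>u' = u\<^bsub>k+1\<^esub>\<close>.\<close>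

primrec samgda_inner ::
  "('b::euclidean_space \<Rightarrow> ereal) \<Rightarrow> ('a::euclidean_space \<times> 'b \<Rightarrow> real) \<Rightarrow> real \<Rightarrow> real
    \<Rightarrow> 'a \<Rightarrow> 'b \<Rightarrow> 'a \<Rightarrow> nat \<Rightarrow> 'b" where
  "samgda_inner g \<phi> \<tau> Lvv u v u' 0 = v"
| "samgda_inner g \<phi> \<tau> Lvv u v u' (Suc j) =
     (let \<eta> = \<tau> / (1 + 2 * Lvv * \<tau>);
          w = samgda_inner g \<phi> \<tau> Lvv u v u' j
      in prox (\<lambda>z. ereal \<eta> * g z)
           ((\<eta> / \<tau>) *\<^sub>R (v - \<tau> *\<^sub>R grad_v \<phi> (u, v))
             + (2 * \<eta> * Lvv) *\<^sub>R (w + (1 / Lvv) *\<^sub>R grad_v \<phi> (u', w))))"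

definition samgda_step ::
  "('a::euclidean_space \<Rightarrow> ereal) \<Rightarrow> ('b::euclidean_space \<Rightarrow> ereal) \<Rightarrow> ('a \<times> 'b \<Rightarrow> real)
    \<Rightarrow> real \<Rightarrow> real \<Rightarrow> nat \<Rightarrow> 'a \<times> 'b \<Rightarrow> 'a \<times> 'b" where
  "samgda_step f g \<phi> \<tau> Lvv J = (\<lambda>(u, v).
     let u' = prox (\<lambda>z. ereal \<tau> * f z) (u - \<tau> *\<^sub>R grad_u \<phi> (u, v))
     in (u', samgda_inner g \<phi> \<tau> Lvv u v u' J))"

primrec samgda ::
  "('a::euclidean_space \<Rightarrow> ereal) \<Rightarrow> ('b::euclidean_space \<Rightarrow> ereal) \<Rightarrow> ('a \<times> 'b \<Rightarrow> real)
    \<Rightarrow> real \<Rightarrow> real \<Rightarrow> nat \<Rightarrow> 'a \<times> 'b \<Rightarrow> nat \<Rightarrow> 'a \<times> 'b" where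
  "samgda f g \<phi> \<tau> Lvv J x0 0 = x0"
| "samgda f g \<phi> \<tau> Lvv J x0 (Suc k) = samgda_step f g \<phi> \<tau> Lvv J (samgda f g \<phi> \<tau> Lvv J x0 k)"

end

theory Submission
  imports Defs
begin

text \<open>
  Write \<open>\<beta> = 1/\<tau> + L\<close> and \<open>y\<^sub>i = R x\<^sub>i\<close>. The step-size bound makes \<open>h\<close> convex and \<open>\<beta>\<close>-smooth,
  so its gradient is cocoercive: the residual \<open>s = \<nabla>h(x\<^sub>i) - \<nabla>h(y\<^sub>i)\<close>, an element of \<open>M y\<^sub>i\<close>,
  satisfies \<open>\<parallel>s\<parallel>\<^sup>2 \<le> 2 \<beta> D_h(y\<^sub>i, x\<^sub>i)\<close> (\<open>norm_residual_le_bregman\<close>). This is the first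
  inequality. Inserting \<open>s\<close> into the weak Minty inequality and into the three-point identity gives
  \<open>(1 - \<rho> \<beta>) D_h(y\<^sub>i, x\<^sub>i) + D_h(x\<^sub>*, y\<^sub>i) \<le> D_h(x\<^sub>*, x\<^sub>i)\<close> (\<open>resolvent_fejer\<close>).

  For the exact method, with \<open>x\<^sub>i\<^sub>+\<^sub>1 = y\<^sub>i\<close>, these inequalities telescope. The coupling term in
  \<open>h\<close> makes the resolvent equation triangular: its \<open>u\<close>-block is the explicit proximal step of the
  method, and its \<open>v\<close>-block is the fixed-point equation that the inner loop iterates. Hence
  \<open>x\<^sub>i\<^sub>+\<^sub>1\<close> and \<open>y\<^sub>i\<close> differ only by the error of the inner loop, a forward-backward iteration
  with ratio \<open>4 L\<^sub>v\<^sub>v / (1/\<tau> + 2 L\<^sub>v\<^sub>v)\<close> (\<open>inner_contraction\<close>). By \<open>bregman_perturb\<close> an error \<open>e\<close>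
  costs at most \<open>3/2 \<beta> \<Omega> e\<close>, and the bounded domain starts the geometric decay of \<open>e\<close> at \<open>\<Omega>\<close>.

  One point needs care: \<open>x\<^sub>0\<close> may lie outside the domain, and then the decay in the first outer
  step starts from \<open>\<Omega>\<close> only after one inner iteration. That step may therefore cost twice the
  regular amount (\<open>step_error_cold\<close>). The telescoped sum absorbs this, because the error of the
  last outer step never enters it (\<open>fejer_sum\<close>).

  That \<open>R\<close> and the proximal maps are well defined rests on \<open>resolvent_exists\<close>, the surjectivity
  of \<open>\<alpha> I + \<partial>f\<close>, and for the implicit \<open>v\<close>-block on Banach's fixed-point theorem.
\<close>

section \<open>Resolvents of subdifferentials\<close>

lemma mem_translate_iff: "t \<in> (\<lambda>p. c + p) ` S \<longleftrightarrow> t - c \<in> S"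
  for t c :: "'a::ab_group_add"
proof
  assume "t - c \<in> S"
  then have "c + (t - c) \<in> (\<lambda>p. c + p) ` S" by (rule imageI)
  then show "t \<in> (\<lambda>p. c + p) ` S" by simp
qed auto

lemma subdiff_imp_effdom:
  assumes "proper f" "p \<in> subdiff f x"
  shows "x \<in> effdom f"
proof -
  obtain z where "f z < \<infinity>"
    using assms(1) by (auto simp: proper_def effdom_def)
  moreover have "f x + ereal (p \<bullet> (z - x)) \<le> f z"
    using assms(2) by (simp add: subdiff_def)
  ultimately show ?thesis
    by (cases "f x") (auto simp: effdom_def)
qed

lemma subdiff_iff_real:
  assumes "f x = ereal a"
  shows "p \<in> subdiff f x \<longleftrightarrow> (\<forall>z r. f z \<le> ereal r \<longrightarrow> a + p \<bullet> (z - x) \<le> r)"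
proof
  assume p: "p \<in> subdiff f x"
  show "\<forall>z r. f z \<le> ereal r \<longrightarrow> a + p \<bullet> (z - x) \<le> r"
  proof (intro allI impI)
    fix z r assume "f z \<le> ereal r"
    moreover have "f x + ereal (p \<bullet> (z - x)) \<le> f z"
      using p by (simp add: subdiff_def)
    ultimately have "f x + ereal (p \<bullet> (z - x)) \<le> ereal r"
      by (rule order_trans[rotated])
    then show "a + p \<bullet> (z - x) \<le> r" by (simp add: assms)
  qed
next
  assume r: "\<forall>z r. f z \<le> ereal r \<longrightarrow> a + p \<bullet> (z - x) \<le> r"
  show "p \<in> subdiff f x"
    unfolding subdiff_def
  proof (intro CollectI allI)
    fix z
    show "f x + ereal (p \<bullet> (z - x)) \<le> f z"
    proof (cases "f z")
      case (real b)
      then show ?thesis using r[rule_format, of z b] by (simp add: assms)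
    next
      case MInf
      then show ?thesis using r[rule_format, of z "a + p \<bullet> (z - x) - 1"] by simp
    qed simp
  qed
qed

lemma subdiff_finite:
  assumes "proper f" "p \<in> subdiff f x"
  obtains a where "f x = ereal a"
  using subdiff_imp_effdom[OF assms] assms(1)
  by (cases "f x") (auto simp: effdom_def proper_def)

text \<open>Closedness in \<open>p\<close>: the subgradient inequalities, read at the points of the epigraph, are
  closed half-spaces.\<close>

lemma closed_subdiff:
  assumes "proper f"
  shows "closed (subdiff f x)"
proof (cases "subdiff f x = {}")
  case False
  then obtain a where a: "f x = ereal a"
    using subdiff_finite[OF assms] by (meson ex_in_conv)
  have "subdiff f x = (\<Inter>z. \<Inter>r\<in>{r. f z \<le> ereal r}. {p. a + p \<bullet> (z - x) \<le> r})"
    by (auto simp: subdiff_iff_real[of f x, OF a])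
  also have "closed \<dots>"
    by (intro closed_INT ballI closed_Collect_le continuous_intros)
  finally show ?thesis .
qed simp

lemma subdiff_monotone:
  assumes f: "proper f" and p: "p \<in> subdiff f x" and q: "q \<in> subdiff f y"
  shows "0 \<le> (p - q) \<bullet> (x - y)"
proof -
  obtain a b where a: "f x = ereal a" and b: "f y = ereal b"
    using subdiff_finite[OF f p] subdiff_finite[OF f q] by metis
  have "a + p \<bullet> (y - x) \<le> b" "b + q \<bullet> (x - y) \<le> a"
    using p q a b subdiff_iff_real by fastforce+
  then show ?thesis by (simp add: inner_diff_left inner_diff_right)
qed

lemma subdiff_scale:
  assumes "0 < c"
  shows "p \<in> subdiff (\<lambda>z. ereal c * f z) x \<longleftrightarrow> (1 / c) *\<^sub>R p \<in> subdiff f x"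
proof -
  have "ereal c * f x + ereal (p \<bullet> (z - x)) \<le> ereal c * f z \<longleftrightarrow>
        f x + ereal ((1 / c) * (p \<bullet> (z - x))) \<le> f z" for z
    using assms by (cases "f x"; cases "f z") (auto simp: field_simps)
  then show ?thesis by (simp add: subdiff_def)
qed

text \<open>The inclusion \<open>c - \<alpha> p \<in> \<partial>f(p)\<close> says \<open>p = (\<alpha> I + \<partial>f)\<inverse> c\<close>. Strong monotonicity of
  \<open>\<alpha> I + \<partial>f\<close> makes this resolvent Lipschitz.\<close>

lemma resolvent_lipschitz:
  assumes f: "proper f"
    and p: "c - \<alpha> *\<^sub>R p \<in> subdiff f p" and q: "d - \<alpha> *\<^sub>R q \<in> subdiff f q"
  shows "\<alpha> * norm (p - q) \<le> norm (c - d)"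
proof (cases "p = q")
  case False
  have "0 \<le> ((c - \<alpha> *\<^sub>R p) - (d - \<alpha> *\<^sub>R q)) \<bullet> (p - q)"
    by (rule subdiff_monotone[OF f p q])
  also have "(c - \<alpha> *\<^sub>R p) - (d - \<alpha> *\<^sub>R q) = (c - d) - \<alpha> *\<^sub>R (p - q)"
    by (simp add: algebra_simps)
  also have "\<dots> \<bullet> (p - q) = (c - d) \<bullet> (p - q) - \<alpha> * (norm (p - q))\<^sup>2"
    by (simp add: inner_diff_left[of _ "\<alpha> *\<^sub>R (p - q)"] power2_norm_eq_inner)
  finally have "\<alpha> * (norm (p - q))\<^sup>2 \<le> norm (c - d) * norm (p - q)"
    using norm_cauchy_schwarz[of "c - d" "p - q"] by linarith
  then have "(\<alpha> * norm (p - q)) * norm (p - q) \<le> norm (c - d) * norm (p - q)"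
    by (simp add: power2_eq_square mult.assoc)
  then show ?thesis
    using False by (simp add: mult_le_cancel_right)
qed simp

lemma resolvent_unique:
  assumes "proper f" "0 < \<alpha>" "c - \<alpha> *\<^sub>R p \<in> subdiff f p" "c - \<alpha> *\<^sub>R q \<in> subdiff f q"
  shows "p = q"
  using resolvent_lipschitz[OF assms(1,3,4)] assms(2) by (simp add: mult_le_0_iff)

text \<open>Sublevel sets of a function with closed epigraph are closed, hence compact when the domain
  is bounded; were they all nonempty, a common point would have value \<open>-\<infinity>\<close>.\<close>

lemma bounded_below_of_bounded_effdom:
  fixes f :: "'a::euclidean_space \<Rightarrow> ereal"
  assumes cl: "closed (epi f)" and f: "proper f" and bd: "bounded (effdom f)"
  obtains m where "\<And>z. ereal m \<le> f z"
proof -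
  let ?F = "\<lambda>n::nat. {z. f z \<le> ereal (- real n)}"
  have "\<exists>n. ?F n = {}"
  proof (rule ccontr)
    assume "\<not> ?thesis"
    then have ne: "?F n \<noteq> {}" for n by blast
    have "closed ((\<lambda>z. (z, - real n)) -` epi f)" for n
      by (intro closed_vimage cl continuous_intros)
    then have "closed (?F n)" for n
      by (simp add: epi_def vimage_def)
    moreover have "bounded (?F n)" for n
      by (rule bounded_subset[OF bd]) (auto simp: effdom_def intro: le_less_trans)
    ultimately have "\<Inter>(range ?F) \<noteq> {}"
      by (intro compact_nest ne) (auto simp: compact_eq_bounded_closed elim!: order_trans)
    then obtain z where z: "\<And>n. f z \<le> ereal (- real n)" by auto
    have "f z = - \<infinity>"
    proof (cases "f z")
      case (real r)
      obtain n :: nat where "real n > - r" using reals_Archimedean2 by blast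
      with z[of n] show ?thesis by (simp add: real)
    next
      case PInf
      then show ?thesis using z[of 0] by simp
    qed simp
    then show False using f by (simp add: proper_def)
  qed
  then obtain n where "?F n = {}" by blast
  then have "ereal (- real n) \<le> f z" for z by (metis (mono_tags) empty_Collect_eq linear)
  then show thesis by (rule that)
qed

text \<open>The point \<open>(\<alpha> I + \<partial>f)\<inverse> c\<close> minimizes \<open>f(z) + \<alpha>/2 \<parallel>z\<parallel>\<^sup>2 - \<langle>c, z\<rangle>\<close>. The minimum is sought
  on the epigraph, where the objective becomes continuous; cut off at the height \<open>t0\<close> of a
  starting point, a bounded domain makes the epigraph compact.\<close>

lemma resolvent_exists:
  fixes f :: "'a::euclidean_space \<Rightarrow> ereal"
  assumes cpc: "closed_proper_convex f" and bd: "bounded (effdom f)" and \<alpha>: "0 \<le> \<alpha>"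
  obtains p where "c - \<alpha> *\<^sub>R p \<in> subdiff f p"
proof -
  have cl: "closed (epi f)" and f: "proper f" and cvx: "convex (epi f)"
    using cpc by (auto simp: closed_proper_convex_def)
  obtain m where m: "\<And>z. ereal m \<le> f z"
    using bounded_below_of_bounded_effdom[OF cl f bd] by blast
  obtain z0 where "f z0 < \<infinity>" using f by (auto simp: proper_def effdom_def)
  then obtain t0 where t0: "f z0 = ereal t0"
    using f by (cases "f z0") (auto simp: proper_def)
  define q where "q = (\<lambda>z. \<alpha> / 2 * (norm z)\<^sup>2 - c \<bullet> z)"
  obtain B where B: "\<And>z. z \<in> effdom f \<Longrightarrow> norm z \<le> B"
    using bd by (auto simp: bounded_iff)
  have qB: "bounded (q ` effdom f)"
  proof (rule bounded_subset)
    show "bounded (q ` closure (effdom f))"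
      unfolding q_def
      by (intro compact_imp_bounded compact_continuous_image continuous_intros)
        (use bd in \<open>simp add: compact_closure\<close>)
  qed (use closure_subset in blast)
  then obtain Q where Q: "\<And>z. z \<in> effdom f \<Longrightarrow> \<bar>q z\<bar> \<le> Q"
    by (auto simp: bounded_iff)
  define S where "S = epi f \<inter> (UNIV \<times> {.. t0 + 2 * Q})"
  have sub: "S \<subseteq> effdom f \<times> {m .. t0 + 2 * Q}"
  proof
    fix y assume "y \<in> S"
    then obtain z t where y: "y = (z, t)" and le: "f z \<le> ereal t" "t \<le> t0 + 2 * Q"
      by (auto simp: S_def epi_def)
    have "ereal m \<le> ereal t" using m[of z] le(1) by (rule order_trans)
    moreover have "f z < \<infinity>" using le(1) by (auto intro: le_less_trans)
    ultimately show "y \<in> effdom f \<times> {m .. t0 + 2 * Q}"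
      using y le by (simp add: effdom_def)
  qed
  have "bounded S"
    by (rule bounded_subset[OF bounded_Times[OF bd bounded_closed_interval] sub])
  moreover have "closed S"
    unfolding S_def by (intro closed_Int cl closed_Times closed_UNIV closed_atMost)
  ultimately have "compact S" by (simp add: compact_eq_bounded_closed)
  moreover have z0: "z0 \<in> effdom f" using t0 by (simp add: effdom_def)
  have "0 \<le> Q" using Q[OF z0] by linarith
  then have "(z0, t0) \<in> S" using t0 by (simp add: S_def epi_def)
  moreover have "continuous_on S (\<lambda>y. snd y + q (fst y))"
    unfolding q_def by (intro continuous_intros)
  ultimately obtain y where yS: "y \<in> S"
    and ymin: "\<And>w. w \<in> S \<Longrightarrow> snd y + q (fst y) \<le> snd w + q (fst w)"
    using continuous_attains_inf[of S "\<lambda>y. snd y + q (fst y)"] by blast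
  obtain p t where y: "y = (p, t)" by (cases y)
  have pt: "f p \<le> ereal t" using yS y by (simp add: S_def epi_def)
  have min: "t + q p \<le> r + q z" if "f z \<le> ereal r" for z r
  proof (cases "r \<le> t0 + 2 * Q")
    case True
    then show ?thesis using ymin[of "(z, r)"] that y by (simp add: S_def epi_def)
  next
    case False
    have "z \<in> effdom f" using that by (auto simp: effdom_def intro: le_less_trans)
    then have "- Q \<le> q z" "q z0 \<le> Q" using Q[of z] Q[OF z0] by linarith+
    moreover have "t + q p \<le> t0 + q z0" using ymin[OF \<open>(z0, t0) \<in> S\<close>] y by simp
    ultimately show ?thesis using False by linarith
  qed
  obtain a where a: "f p = ereal a" "a \<le> t"
    using pt f by (cases "f p") (auto simp: proper_def)
  have "a + (c - \<alpha> *\<^sub>R p) \<bullet> (z - p) \<le> r" if zr: "f z \<le> ereal r" for z r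
  proof -
    define d where "d = z - p"
    define A where "A = t - r + (c - \<alpha> *\<^sub>R p) \<bullet> d"
    \<comment> \<open>Minimality along the segment from \<open>(p, t)\<close> to \<open>(z, r)\<close>, divided by its parameter \<open>s\<close>.\<close>
    have A: "A \<le> s * (\<alpha> / 2 * (norm d)\<^sup>2)" if s: "0 < s" "s \<le> 1" for s
    proof -
      have "(1 - s) *\<^sub>R (p, t) + s *\<^sub>R (z, r) \<in> epi f"
        by (rule convexD_alt[OF cvx]) (use pt zr s in \<open>auto simp: epi_def\<close>)
      then have "f (p + s *\<^sub>R d) \<le> ereal ((1 - s) * t + s * r)"
        by (simp add: epi_def d_def algebra_simps)
      then have "t + q p \<le> (1 - s) * t + s * r + q (p + s *\<^sub>R d)" by (rule min)
      also have "q (p + s *\<^sub>R d) = q p + s * (\<alpha> * (p \<bullet> d) - c \<bullet> d) + s * s * (\<alpha> / 2 * (norm d)\<^sup>2)"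
        by (simp add: q_def power2_norm_eq_inner algebra_simps inner_commute[of d p] field_simps)
      finally have "s * A \<le> s * (s * (\<alpha> / 2 * (norm d)\<^sup>2))"
        by (simp add: A_def algebra_simps)
      then show ?thesis using s by simp
    qed
    have "A \<le> 0"
    proof (rule tendsto_lowerbound[of "\<lambda>s. s * (\<alpha> / 2 * (norm d)\<^sup>2)" 0 "at_right (0::real)"])
      have "((\<lambda>s. s * (\<alpha> / 2 * (norm d)\<^sup>2)) \<longlongrightarrow> 0 * (\<alpha> / 2 * (norm d)\<^sup>2)) (at_right (0::real))"
        by (intro tendsto_intros)
      then show "((\<lambda>s. s * (\<alpha> / 2 * (norm d)\<^sup>2)) \<longlongrightarrow> 0) (at_right (0::real))" by simp
      show "\<forall>\<^sub>F s in at_right 0. A \<le> s * (\<alpha> / 2 * (norm d)\<^sup>2)"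
        unfolding eventually_at_right_field by (intro exI[of _ 1] conjI allI impI A) auto
    qed simp
    then show ?thesis using a(2) by (simp add: A_def d_def)
  qed
  then have "c - \<alpha> *\<^sub>R p \<in> subdiff f p" by (simp add: subdiff_iff_real[of f p, OF a(1)])
  then show thesis by (rule that)
qed

lemma prox_scale_eq_iff:
  fixes f :: "'a::euclidean_space \<Rightarrow> ereal"
  assumes cpc: "closed_proper_convex f" and bd: "bounded (effdom f)" and \<eta>: "0 < \<eta>"
  shows "prox (\<lambda>z. ereal \<eta> * f z) y = p \<longleftrightarrow> (1 / \<eta>) *\<^sub>R y - (1 / \<eta>) *\<^sub>R p \<in> subdiff f p"
proof -
  have f: "proper f" using cpc by (simp add: closed_proper_convex_def)
  have eq: "y \<in> (\<lambda>w. p + w) ` subdiff (\<lambda>z. ereal \<eta> * f z) p \<longleftrightarrow>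
      (1 / \<eta>) *\<^sub>R y - (1 / \<eta>) *\<^sub>R p \<in> subdiff f p" for p
    by (simp only: mem_translate_iff subdiff_scale[OF \<eta>] scaleR_diff_right)
  obtain p' where p': "(1 / \<eta>) *\<^sub>R y - (1 / \<eta>) *\<^sub>R p' \<in> subdiff f p'"
    by (rule resolvent_exists[OF cpc bd, of "1 / \<eta>" "(1 / \<eta>) *\<^sub>R y"]) (use \<eta> in auto)
  have uniq: "q = p'" if "(1 / \<eta>) *\<^sub>R y - (1 / \<eta>) *\<^sub>R q \<in> subdiff f q" for q
    using resolvent_unique[OF f _ that p'] \<eta> by simp
  have "prox (\<lambda>z. ereal \<eta> * f z) y = p'"
    unfolding prox_def eq by (rule the_equality) (fact p', fact uniq)
  then show ?thesis using p' uniq by metis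
qed

section \<open>Gradients and the Bregman distance\<close>

lemma gradient_eqI:
  assumes "GDERIV F x :> D"
  shows "gradient F x = D"
  unfolding gradient_def
proof (rule the_equality)
  fix E assume "GDERIV F x :> E"
  then have "(\<lambda>d. d \<bullet> E) = (\<lambda>d. d \<bullet> D)"
    using assms has_derivative_unique unfolding gderiv_def by blast
  then have "d \<bullet> (E - D) = 0" for d by (metis inner_diff_right eq_iff_diff_eq_0)
  then show "E = D" by (metis inner_eq_zero_iff eq_iff_diff_eq_0)
qed (fact assms)

lemma GDERIV_gradient:
  assumes "cont_diff F"
  shows "GDERIV F x :> gradient F x"
  using assms gradient_eqI unfolding cont_diff_def by metis

lemma grad_u_eq:
  assumes "cont_diff \<phi>"
  shows "grad_u \<phi> x = fst (gradient \<phi> x)"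
proof -
  have "((\<lambda>u. (u, snd x)) has_derivative (\<lambda>d. (d, 0))) (at (fst x))"
    by (auto intro!: derivative_eq_intros)
  then have "((\<lambda>u. \<phi> (u, snd x)) has_derivative (\<lambda>d. (d, 0) \<bullet> gradient \<phi> (fst x, snd x))) (at (fst x))"
    using GDERIV_gradient[OF assms, of "(fst x, snd x)"] unfolding gderiv_def
    by (rule has_derivative_compose)
  then show ?thesis
    unfolding grad_u_def by (intro gradient_eqI) (simp add: gderiv_def inner_prod_def)
qed

lemma grad_v_eq:
  assumes "cont_diff \<phi>"
  shows "grad_v \<phi> x = snd (gradient \<phi> x)"
proof -
  have "((\<lambda>v. (fst x, v)) has_derivative (\<lambda>d. (0, d))) (at (snd x))"
    by (auto intro!: derivative_eq_intros)
  then have "((\<lambda>v. \<phi> (fst x, v)) has_derivative (\<lambda>d. (0, d) \<bullet> gradient \<phi> (fst x, snd x))) (at (snd x))"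
    using GDERIV_gradient[OF assms, of "(fst x, snd x)"] unfolding gderiv_def
    by (rule has_derivative_compose)
  then show ?thesis
    unfolding grad_v_def by (intro gradient_eqI) (simp add: gderiv_def inner_prod_def)
qed

lemma kernel_h_eq: "kernel_h \<tau> \<phi> x = 1 / (2 * \<tau>) * (x \<bullet> x) - \<phi> x"
  by (cases x) (simp add: kernel_h_def inner_prod_def power2_norm_eq_inner)

lemma gradient_kernel_h:
  assumes "cont_diff \<phi>"
  shows "gradient (kernel_h \<tau> \<phi>) x = (1 / \<tau>) *\<^sub>R x - gradient \<phi> x"
proof (rule gradient_eqI)
  have "((\<lambda>x. c * (x \<bullet> x) - \<phi> x) has_derivative
      (\<lambda>d. c * (x \<bullet> d + d \<bullet> x) - d \<bullet> gradient \<phi> x)) (at x)" for c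
    using GDERIV_gradient[OF assms, of x] unfolding gderiv_def
    by (auto intro!: derivative_eq_intros)
  then show "GDERIV (kernel_h \<tau> \<phi>) x :> (1 / \<tau>) *\<^sub>R x - gradient \<phi> x"
    unfolding gderiv_def kernel_h_eq[abs_def]
    by (rule has_derivative_eq_rhs) (auto simp: inner_commute inner_diff_right)
qed

lemma bregman_uminus:
  assumes "cont_diff F"
  shows "bregman (\<lambda>x. - F x) x y = - bregman F x y"
  using gradient_eqI[OF GDERIV_minus[OF GDERIV_gradient[OF assms, of y]]]
  by (simp add: bregman_def)

text \<open>Along the segment, \<open>F\<close> minus its linearization and minus \<open>L t\<^sup>2/2 \<parallel>x - y\<parallel>\<^sup>2\<close> has a nonpositive
  derivative.\<close>

lemma bregman_le_of_lipschitz_gradient: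
  assumes cd: "cont_diff F" and lip: "L-lipschitz_on UNIV (gradient F)"
  shows "bregman F x y \<le> L / 2 * (norm (x - y))\<^sup>2"
proof -
  define d where "d = x - y"
  define G where "G = (\<lambda>t. F (y + t *\<^sub>R d) - t * (gradient F y \<bullet> d) - L / 2 * t\<^sup>2 * (norm d)\<^sup>2)"
  have der: "DERIV G t :> (gradient F (y + t *\<^sub>R d) - gradient F y) \<bullet> d - L * t * (norm d)\<^sup>2" for t
  proof -
    have "((\<lambda>t. y + t *\<^sub>R d) has_derivative (\<lambda>s. s *\<^sub>R d)) (at t)"
      by (auto intro!: derivative_eq_intros)
    then have "((\<lambda>t. F (y + t *\<^sub>R d)) has_derivative (\<lambda>s. (s *\<^sub>R d) \<bullet> gradient F (y + t *\<^sub>R d))) (at t)"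
      using GDERIV_gradient[OF cd, of "y + t *\<^sub>R d"] unfolding gderiv_def
      by (rule has_derivative_compose)
    then have "DERIV (\<lambda>t. F (y + t *\<^sub>R d)) t :> d \<bullet> gradient F (y + t *\<^sub>R d)"
      by (rule has_derivative_imp_has_field_derivative) simp
    then show ?thesis
      unfolding G_def
      by (auto intro!: derivative_eq_intros simp: inner_diff_left inner_commute[of d])
  qed
  have "G 1 \<le> G 0"
  proof (rule DERIV_nonpos_imp_nonincreasing[of 0 1 G])
    fix t :: real assume t: "0 \<le> t" "t \<le> 1"
    have "(gradient F (y + t *\<^sub>R d) - gradient F y) \<bullet> d \<le>
        norm (gradient F (y + t *\<^sub>R d) - gradient F y) * norm d"
      by (rule norm_cauchy_schwarz)
    also have "\<dots> \<le> (L * (t * norm d)) * norm d"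
      using lipschitz_onD[OF lip, of "y + t *\<^sub>R d" y] t
      by (intro mult_right_mono) (simp_all add: dist_norm)
    finally show "\<exists>D. DERIV G t :> D \<and> D \<le> 0"
      by (intro exI[of _ "(gradient F (y + t *\<^sub>R d) - gradient F y) \<bullet> d - L * t * (norm d)\<^sup>2"] conjI der)
        (simp add: power2_eq_square mult.assoc)
  qed simp
  then show ?thesis
    by (simp add: G_def d_def bregman_def)
qed

lemma bregman_ge_of_lipschitz_gradient:
  assumes cd: "cont_diff F" and lip: "L-lipschitz_on UNIV (gradient F)"
  shows "- (L / 2 * (norm (x - y))\<^sup>2) \<le> bregman F x y"
proof -
  have grad: "gradient (\<lambda>x. - F x) = (\<lambda>x. - gradient F x)"
    by (intro ext gradient_eqI GDERIV_minus GDERIV_gradient cd)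
  have "cont_diff (\<lambda>x. - F x)"
    unfolding cont_diff_def grad
    using cd by (auto simp: cont_diff_def intro!: continuous_intros GDERIV_minus)
  moreover have "L-lipschitz_on UNIV (gradient (\<lambda>x. - F x))"
    unfolding grad using lip by (simp add: lipschitz_on_def dist_minus)
  ultimately have "bregman (\<lambda>x. - F x) x y \<le> L / 2 * (norm (x - y))\<^sup>2"
    by (rule bregman_le_of_lipschitz_gradient)
  then show ?thesis by (simp add: bregman_uminus[OF cd])
qed

lemma bregman_three_point:
  "bregman h z x = bregman h z y + bregman h y x + (gradient h x - gradient h y) \<bullet> (y - z)"
  by (simp add: bregman_def inner_diff_left inner_diff_right)

text \<open>A convex function with \<open>D_h(x, y) \<le> \<beta>/2 \<parallel>x - y\<parallel>\<^sup>2\<close> is cocoercive: evaluate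
  \<open>0 \<le> D_h(z, y)\<close> at the gradient step \<open>z = x - (\<nabla>h(x) - \<nabla>h(y))/\<beta>\<close>.\<close>

lemma norm_gradient_diff_le_bregman:
  assumes nonneg: "\<And>x y. 0 \<le> bregman h x y"
    and upper: "\<And>x y. bregman h x y \<le> \<beta> / 2 * (norm (x - y))\<^sup>2" and \<beta>: "0 < \<beta>"
  shows "(norm (gradient h x - gradient h y))\<^sup>2 / (2 * \<beta>) \<le> bregman h x y"
proof -
  define s where "s = gradient h x - gradient h y"
  define z where "z = x - (1 / \<beta>) *\<^sub>R s"
  have "0 \<le> bregman h z y" by (rule nonneg)
  also have "\<dots> = bregman h z x + bregman h x y + (gradient h y - gradient h x) \<bullet> (x - z)"
    by (rule bregman_three_point)
  also have "(gradient h y - gradient h x) \<bullet> (x - z) = - s \<bullet> ((1 / \<beta>) *\<^sub>R s)"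
    by (simp add: z_def s_def)
  also have "\<dots> = - ((norm s)\<^sup>2 / \<beta>)"
    by (simp add: power2_norm_eq_inner)
  also have "bregman h z x \<le> \<beta> / 2 * (norm (z - x))\<^sup>2" by (rule upper)
  also have "\<dots> = (norm s)\<^sup>2 / (2 * \<beta>)"
    using \<beta> by (simp add: z_def power_mult_distrib power_divide field_simps power2_eq_square)
  finally have "0 \<le> (norm s)\<^sup>2 / (2 * \<beta>) + bregman h x y - (norm s)\<^sup>2 / \<beta>" by simp
  then show ?thesis using \<beta> by (simp add: s_def field_simps)
qed

section \<open>The saddle operator and its \<open>h\<close>-resolvent\<close>

locale composite_saddle =
  fixes f :: "'a::euclidean_space \<Rightarrow> ereal" and g :: "'b::euclidean_space \<Rightarrow> ereal"
    and \<phi> :: "'a \<times> 'b \<Rightarrow> real" and Luu Luv Lvu Lvv L \<Omega> \<tau> :: real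
  assumes smooth: "composite_smooth f g \<phi> Luu Luv Lvu Lvv"
    and L_pos: "0 < L" and lip: "L-lipschitz_on UNIV (gradient \<phi>)"
    and bdd: "bounded_domain f g \<Omega>"
    and \<tau>_pos: "0 < \<tau>" and step_size: "L + Lvv < 1 / \<tau>"
begin

abbreviation (input) "h \<equiv> kernel_h \<tau> \<phi>"
abbreviation (input) "M \<equiv> saddle_op f g \<phi>"
abbreviation (input) "R \<equiv> h_resolvent h M"
abbreviation (input) "\<beta> \<equiv> 1 / \<tau> + L"

lemma f_cpc: "closed_proper_convex f" and g_cpc: "closed_proper_convex g"
  and cd: "cont_diff \<phi>" and Lvv_pos: "0 < Lvv"
  using smooth by (auto simp: composite_smooth_def)

lemma f_proper: "proper f" and g_proper: "proper g"
  using f_cpc g_cpc by (auto simp: closed_proper_convex_def)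

lemma norm_diff_le_diameter:
  assumes "fst x \<in> effdom f" "snd x \<in> effdom g" "fst y \<in> effdom f" "snd y \<in> effdom g"
  shows "norm (x - y) \<le> \<Omega>"
proof -
  have "x \<in> effdom f \<times> effdom g" "y \<in> effdom f \<times> effdom g"
    using assms by (simp_all add: mem_Times_iff)
  then show ?thesis using bdd unfolding bounded_domain_def by blast
qed

lemma norm_diff_le_diameter_g:
  assumes "v \<in> effdom g" "w \<in> effdom g"
  shows "norm (v - w) \<le> \<Omega>"
proof -
  obtain u where "u \<in> effdom f" using f_proper by (auto simp: proper_def)
  then show ?thesis
    using norm_diff_le_diameter[of "(u, v)" "(u, w)"] assms by (simp add: norm_Pair)
qed

lemma norm_diff_le_diameter_f:
  assumes "u \<in> effdom f" "w \<in> effdom f"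
  shows "norm (u - w) \<le> \<Omega>"
proof -
  obtain v where "v \<in> effdom g" using g_proper by (auto simp: proper_def)
  then show ?thesis
    using norm_diff_le_diameter[of "(u, v)" "(w, v)"] assms by (simp add: norm_Pair)
qed

lemma diameter_nonneg: "0 \<le> \<Omega>"
proof -
  obtain u where "u \<in> effdom f" using f_proper by (auto simp: proper_def)
  then show ?thesis using norm_diff_le_diameter_f[of u u] by simp
qed

lemma bounded_effdom_f: "bounded (effdom f)"
proof -
  obtain u where "u \<in> effdom f" using f_proper by (auto simp: proper_def)
  then have "\<forall>y\<in>effdom f. dist u y \<le> \<Omega>"
    using norm_diff_le_diameter_f by (simp add: dist_norm)
  then show ?thesis unfolding bounded_def by blast
qed

lemma bounded_effdom_g: "bounded (effdom g)"
proof -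
  obtain u where "u \<in> effdom g" using g_proper by (auto simp: proper_def)
  then have "\<forall>y\<in>effdom g. dist u y \<le> \<Omega>"
    using norm_diff_le_diameter_g by (simp add: dist_norm)
  then show ?thesis unfolding bounded_def by blast
qed

lemma grad_v_lipschitz_Lvv: "norm (grad_v \<phi> (u, v) - grad_v \<phi> (u, w)) \<le> Lvv * norm (v - w)"
proof -
  have "norm (grad_v \<phi> (u, v) - grad_v \<phi> (u, w)) \<le> Lvu * norm (u - u) + Lvv * norm (v - w)"
    using smooth unfolding composite_smooth_def by blast
  then show ?thesis by simp
qed

lemma grad_v_lipschitz_L: "norm (grad_v \<phi> (u, v) - grad_v \<phi> (u, w)) \<le> L * norm (v - w)"
proof -
  have "norm (snd (gradient \<phi> (u, v) - gradient \<phi> (u, w))) \<le> norm (gradient \<phi> (u, v) - gradient \<phi> (u, w))"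
    by (cases "gradient \<phi> (u, v) - gradient \<phi> (u, w)") (simp add: norm_snd_le)
  also have "\<dots> \<le> L * norm ((u, v) - (u, w))"
    using lipschitz_onD[OF lip, of "(u, v)" "(u, w)"] by (simp add: dist_norm)
  finally show ?thesis by (simp add: grad_v_eq[OF cd] norm_Pair)
qed

lemma mem_saddle_op_iff:
  "s \<in> M y \<longleftrightarrow> fst s - grad_u \<phi> y \<in> subdiff f (fst y) \<and> snd s + grad_v \<phi> y \<in> subdiff g (snd y)"
  by (simp only: saddle_op_def mem_Times_iff mem_translate_iff diff_minus_eq_add)

lemma saddle_op_effdom:
  assumes "s \<in> M y"
  shows "fst y \<in> effdom f" "snd y \<in> effdom g"
  using assms subdiff_imp_effdom[OF f_proper] subdiff_imp_effdom[OF g_proper]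
  by (auto simp: mem_saddle_op_iff)

text \<open>With this \<open>h\<close> the coupling \<open>\<nabla>\<^sub>u\<phi>(y)\<close> cancels from the first block, so that the resolvent
  equation becomes triangular: an explicit proximal step in \<open>u\<close>, then an implicit equation in
  \<open>v\<close> alone.\<close>

lemma gradient_diff_mem_saddle_op_iff:
  "gradient h x - gradient h (p, q) \<in> M (p, q) \<longleftrightarrow>
     ((1 / \<tau>) *\<^sub>R fst x - grad_u \<phi> x) - (1 / \<tau>) *\<^sub>R p \<in> subdiff f p \<and>
     ((1 / \<tau>) *\<^sub>R snd x - grad_v \<phi> x + 2 *\<^sub>R grad_v \<phi> (p, q)) - (1 / \<tau>) *\<^sub>R q \<in> subdiff g q"
proof -
  have "fst (gradient h x - gradient h (p, q)) - grad_u \<phi> (p, q) =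
      ((1 / \<tau>) *\<^sub>R fst x - grad_u \<phi> x) - (1 / \<tau>) *\<^sub>R p"
    by (simp add: gradient_kernel_h[OF cd] grad_u_eq[OF cd])
  moreover have "snd (gradient h x - gradient h (p, q)) + grad_v \<phi> (p, q) =
      ((1 / \<tau>) *\<^sub>R snd x - grad_v \<phi> x + 2 *\<^sub>R grad_v \<phi> (p, q)) - (1 / \<tau>) *\<^sub>R q"
    by (simp add: gradient_kernel_h[OF cd] grad_v_eq[OF cd] scaleR_2)
  ultimately show ?thesis by (simp only: mem_saddle_op_iff fst_conv snd_conv)
qed

text \<open>The implicit equation in \<open>v\<close> is the fixed-point equation of
  \<open>q \<mapsto> (I/\<tau> + \<partial>g)\<inverse>(c + 2 \<nabla>\<^sub>v\<phi>(p, q))\<close>. Both \<open>L\<close> and \<open>L\<^sub>v\<^sub>v\<close> are Lipschitz constants of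
  \<open>\<nabla>\<^sub>v\<phi>(p, \<cdot>)\<close>; spending one on each half of the factor \<open>2\<close> shows that the map contracts with
  ratio \<open>\<tau> (L + L\<^sub>v\<^sub>v) < 1\<close>.\<close>

lemma implicit_v_ex1:
  "\<exists>!q. (c + 2 *\<^sub>R grad_v \<phi> (p, q)) - (1 / \<tau>) *\<^sub>R q \<in> subdiff g q"
proof -
  have "\<forall>w. \<exists>q. (c + 2 *\<^sub>R grad_v \<phi> (p, w)) - (1 / \<tau>) *\<^sub>R q \<in> subdiff g q"
    using resolvent_exists[OF g_cpc bounded_effdom_g, of "1 / \<tau>"] \<tau>_pos
    by (metis less_imp_le zero_less_divide_1_iff)
  then obtain T where T: "\<And>w. (c + 2 *\<^sub>R grad_v \<phi> (p, w)) - (1 / \<tau>) *\<^sub>R T w \<in> subdiff g (T w)"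
    by metis
  have "norm (T v - T w) \<le> \<tau> * (L + Lvv) * norm (v - w)" for v w
  proof -
    have "(1 / \<tau>) * norm (T v - T w) \<le> norm (2 *\<^sub>R (grad_v \<phi> (p, v) - grad_v \<phi> (p, w)))"
      using resolvent_lipschitz[OF g_proper T[of v] T[of w]] by (simp add: scaleR_diff_right)
    also have "\<dots> \<le> (L + Lvv) * norm (v - w)"
      using grad_v_lipschitz_L[of p v w] grad_v_lipschitz_Lvv[of p v w] by (simp add: distrib_right)
    finally show ?thesis using \<tau>_pos by (simp add: field_simps)
  qed
  then have "\<forall>v w. dist (T v) (T w) \<le> (\<tau> * (L + Lvv)) * dist v w"
    by (simp add: dist_norm)
  moreover have "0 \<le> \<tau> * (L + Lvv)" "\<tau> * (L + Lvv) < 1"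
    using \<tau>_pos L_pos Lvv_pos step_size by (simp_all add: field_simps)
  ultimately have "\<exists>!q. T q = q"
    using banach_fix_type by blast
  moreover have "T q = q \<longleftrightarrow> (c + 2 *\<^sub>R grad_v \<phi> (p, q)) - (1 / \<tau>) *\<^sub>R q \<in> subdiff g q" for q
    using T[of q] resolvent_unique[OF g_proper _ T[of q], of q] \<tau>_pos by (metis zero_less_divide_1_iff)
  ultimately show ?thesis by simp
qed

lemma h_resolvent_eq_iff: "R x = y \<longleftrightarrow> gradient h x - gradient h y \<in> M y"
proof -
  obtain p where p: "((1 / \<tau>) *\<^sub>R fst x - grad_u \<phi> x) - (1 / \<tau>) *\<^sub>R p \<in> subdiff f p"
    by (rule resolvent_exists[OF f_cpc bounded_effdom_f, of "1 / \<tau>"]) (use \<tau>_pos in auto)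
  have p_unique: "p' = p" if "((1 / \<tau>) *\<^sub>R fst x - grad_u \<phi> x) - (1 / \<tau>) *\<^sub>R p' \<in> subdiff f p'" for p'
    using resolvent_unique[OF f_proper _ that p] \<tau>_pos by simp
  have "\<exists>!y. gradient h x - gradient h y \<in> M y"
  proof -
    obtain q where q: "((1 / \<tau>) *\<^sub>R snd x - grad_v \<phi> x + 2 *\<^sub>R grad_v \<phi> (p, q)) - (1 / \<tau>) *\<^sub>R q \<in> subdiff g q"
      and q_unique: "\<And>q'. ((1 / \<tau>) *\<^sub>R snd x - grad_v \<phi> x + 2 *\<^sub>R grad_v \<phi> (p, q')) - (1 / \<tau>) *\<^sub>R q'
          \<in> subdiff g q' \<Longrightarrow> q' = q"
      using implicit_v_ex1[of "(1 / \<tau>) *\<^sub>R snd x - grad_v \<phi> x" p] by metis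
    show ?thesis
    proof (rule ex1I[of _ "(p, q)"])
      show "gradient h x - gradient h (p, q) \<in> M (p, q)"
        using p q by (simp only: gradient_diff_mem_saddle_op_iff)
      fix y assume y: "gradient h x - gradient h y \<in> M y"
      obtain p' q' where y_eq: "y = (p', q')" by (cases y)
      have "p' = p"
        using y unfolding y_eq gradient_diff_mem_saddle_op_iff by (blast intro: p_unique)
      moreover from this have "q' = q"
        using y unfolding y_eq gradient_diff_mem_saddle_op_iff by (blast intro: q_unique)
      ultimately show "y = (p, q)" by (simp add: y_eq)
    qed
  qed
  then show ?thesis
    unfolding h_resolvent_def mem_translate_iff by (metis (no_types, lifting) theI')
qed

lemma h_resolvent_mem: "gradient h x - gradient h (R x) \<in> M (R x)"
  using h_resolvent_eq_iff by blast

lemmas h_resolvent_effdom = saddle_op_effdom[OF h_resolvent_mem]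

text \<open>\<open>LEAST\<close> on the reals says something only when the minimum is attained, which it is here
  because \<open>M y\<close> is closed.\<close>

lemma Least_norm_le:
  assumes "s \<in> M y" "0 < c"
  shows "(LEAST r. \<exists>s\<in>M y. r = (norm s)\<^sup>2 / c) \<le> (norm s)\<^sup>2 / c"
proof -
  have "M y = (\<lambda>s. (fst s - grad_u \<phi> y, snd s + grad_v \<phi> y)) -` (subdiff f (fst y) \<times> subdiff g (snd y))"
    by (auto simp: mem_saddle_op_iff)
  also have "closed \<dots>"
    by (intro closed_vimage closed_Times closed_subdiff f_proper g_proper continuous_intros)
  finally have "closed (M y)" .
  then obtain s0 where s0: "s0 \<in> M y" "\<And>t. t \<in> M y \<Longrightarrow> dist 0 s0 \<le> dist 0 t"
    using distance_attains_inf assms(1) by blast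
  then have le: "(norm s0)\<^sup>2 / c \<le> (norm t)\<^sup>2 / c" if "t \<in> M y" for t
    using that assms(2) by (intro divide_right_mono power_mono) auto
  have "(LEAST r. \<exists>s\<in>M y. r = (norm s)\<^sup>2 / c) = (norm s0)\<^sup>2 / c"
    by (rule Least_equality) (use s0(1) le in auto)
  then show ?thesis using le[OF assms(1)] by simp
qed

subsection \<open>Bregman estimates for the kernel\<close>

lemma bregman_kernel_h:
  "bregman h x y = 1 / (2 * \<tau>) * (norm (x - y))\<^sup>2 - bregman \<phi> x y"
proof -
  have "1 / (2 * \<tau>) * (x \<bullet> x) - 1 / (2 * \<tau>) * (y \<bullet> y) - (1 / \<tau>) * (y \<bullet> (x - y)) =
      1 / (2 * \<tau>) * ((x - y) \<bullet> (x - y))"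
    using \<tau>_pos by (simp add: inner_diff_left inner_diff_right inner_commute[of y x] field_simps)
  then show ?thesis
    by (simp add: bregman_def kernel_h_eq gradient_kernel_h[OF cd] power2_norm_eq_inner inner_diff_left)
qed

lemma bregman_h_le: "bregman h x y \<le> \<beta> / 2 * (norm (x - y))\<^sup>2"
  using bregman_ge_of_lipschitz_gradient[OF cd lip, of x y]
  by (simp add: bregman_kernel_h algebra_simps add_divide_distrib)

lemma bregman_h_nonneg: "0 \<le> bregman h x y"
proof -
  have "L / 2 * (norm (x - y))\<^sup>2 \<le> 1 / (2 * \<tau>) * (norm (x - y))\<^sup>2"
    using step_size Lvv_pos by (intro mult_right_mono) (simp_all add: field_simps)
  then show ?thesis
    using bregman_le_of_lipschitz_gradient[OF cd lip, of x y] by (simp add: bregman_kernel_h)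
qed

lemma \<beta>_pos: "0 < \<beta>"
  using L_pos \<tau>_pos by (simp add: add_pos_pos)

lemma gradient_h_lipschitz: "norm (gradient h x - gradient h y) \<le> \<beta> * norm (x - y)"
proof -
  have "gradient h x - gradient h y = (1 / \<tau>) *\<^sub>R (x - y) - (gradient \<phi> x - gradient \<phi> y)"
    by (simp add: gradient_kernel_h[OF cd] scaleR_diff_right)
  also have "norm \<dots> \<le> norm ((1 / \<tau>) *\<^sub>R (x - y)) + norm (gradient \<phi> x - gradient \<phi> y)"
    by (rule norm_triangle_ineq4)
  also have "\<dots> \<le> \<beta> * norm (x - y)"
    using lipschitz_onD[OF lip, of x y] \<tau>_pos by (simp add: dist_norm distrib_right)
  finally show ?thesis .
qed

lemma norm_residual_le_bregman:
  "(norm (gradient h x - gradient h y))\<^sup>2 / (2 * \<beta>) \<le> bregman h y x"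
  using norm_gradient_diff_le_bregman[OF bregman_h_nonneg bregman_h_le \<beta>_pos, of y x]
  by (simp add: norm_minus_commute)

text \<open>The weak Minty inequality at \<open>(Rx, \<nabla>h(x) - \<nabla>h(Rx))\<close> costs \<open>\<rho>/2\<close> times the squared norm of
  the residual, which cocoercivity of \<open>\<nabla>h\<close> charges to \<open>D_h(Rx, x)\<close>.\<close>

lemma resolvent_fejer:
  assumes xs: "xs \<in> wmvi_zeros \<rho> M" and \<rho>: "0 \<le> \<rho>"
  shows "(1 - \<rho> * \<beta>) * bregman h (R x) x + bregman h xs (R x) \<le> bregman h xs x"
proof -
  define s where "s = gradient h x - gradient h (R x)"
  have "- (\<rho> / 2) * (norm s)\<^sup>2 \<le> (R x - xs) \<bullet> s"
    using xs h_resolvent_mem[of x] unfolding wmvi_zeros_def gra_def s_def by blast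
  moreover have "bregman h xs x = bregman h xs (R x) + bregman h (R x) x + s \<bullet> (R x - xs)"
    unfolding s_def by (rule bregman_three_point)
  moreover have "(norm s)\<^sup>2 \<le> 2 * \<beta> * bregman h (R x) x"
    using norm_residual_le_bregman[of x "R x"] \<beta>_pos by (simp add: s_def divide_le_eq mult.commute)
  then have "\<rho> / 2 * (norm s)\<^sup>2 \<le> \<rho> / 2 * (2 * \<beta> * bregman h (R x) x)"
    using \<rho> by (intro mult_left_mono) auto
  moreover have "(1 - \<rho> * b) * D = D - \<rho> / 2 * (2 * b * D)" for b D
    by (simp add: algebra_simps)
  note this[of \<beta> "bregman h (R x) x"]
  ultimately show ?thesis unfolding inner_commute[of s] by linarith
qed

text \<open>The cost of replacing the exact resolvent \<open>y\<close> by an approximation \<open>z\<close>: by the three-point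
  identity it is quadratic in \<open>\<parallel>z - y\<parallel>\<close> up to a cross term, in which the other factor is
  bounded by the diameter.\<close>

lemma bregman_perturb:
  assumes e: "norm (z - y) \<le> \<Omega>" and \<Omega>: "norm (xs - y) \<le> \<Omega>"
  shows "bregman h xs z \<le> bregman h xs y + 3 / 2 * \<beta> * \<Omega> * norm (z - y)"
proof -
  have "(gradient h z - gradient h y) \<bullet> (y - xs) \<le>
      norm (gradient h z - gradient h y) * norm (y - xs)"
    by (rule norm_cauchy_schwarz)
  also have "\<dots> \<le> (\<beta> * norm (z - y)) * \<Omega>"
    using gradient_h_lipschitz \<Omega> \<beta>_pos by (intro mult_mono) (auto simp: norm_minus_commute)
  finally have "bregman h xs z \<le> bregman h xs y + bregman h y z + \<beta> * norm (z - y) * \<Omega>"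
    by (simp add: bregman_three_point[of h xs z y])
  moreover have "bregman h y z \<le> \<beta> / 2 * (norm (z - y))\<^sup>2"
    using bregman_h_le[of y z] by (simp add: norm_minus_commute)
  moreover have "\<beta> / 2 * (norm (z - y))\<^sup>2 \<le> \<beta> / 2 * (\<Omega> * norm (z - y))"
    using e \<beta>_pos by (intro mult_left_mono) (auto simp: power2_eq_square intro: mult_right_mono)
  moreover have "3 / 2 * b * \<Omega> * norm (z - y) = b * norm (z - y) * \<Omega> + b / 2 * (\<Omega> * norm (z - y))" for b
    by (simp add: field_simps)
  note this[of \<beta>]
  ultimately show ?thesis by linarith
qed

section \<open>The inner loop\<close>

lemma inner_step_mem:
  "((1 / \<tau>) *\<^sub>R v - grad_v \<phi> (u, v)
      + (2 * Lvv) *\<^sub>R samgda_inner g \<phi> \<tau> Lvv u v u' j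
      + 2 *\<^sub>R grad_v \<phi> (u', samgda_inner g \<phi> \<tau> Lvv u v u' j))
    - (1 / \<tau> + 2 * Lvv) *\<^sub>R samgda_inner g \<phi> \<tau> Lvv u v u' (Suc j)
   \<in> subdiff g (samgda_inner g \<phi> \<tau> Lvv u v u' (Suc j))"
proof -
  define \<eta> where "\<eta> = \<tau> / (1 + 2 * Lvv * \<tau>)"
  define w where "w = samgda_inner g \<phi> \<tau> Lvv u v u' j"
  define y where "y = (\<eta> / \<tau>) *\<^sub>R (v - \<tau> *\<^sub>R grad_v \<phi> (u, v))
      + (2 * \<eta> * Lvv) *\<^sub>R (w + (1 / Lvv) *\<^sub>R grad_v \<phi> (u', w))"
  have den: "0 < 1 + 2 * Lvv * \<tau>" using \<tau>_pos Lvv_pos by (simp add: add_pos_pos)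
  then have \<eta>: "0 < \<eta>" using \<tau>_pos by (simp add: \<eta>_def)
  have \<eta>_inv: "1 / \<eta> = 1 / \<tau> + 2 * Lvv"
    using \<tau>_pos den by (simp add: \<eta>_def field_simps)
  have "(1 / \<eta>) *\<^sub>R y = (1 / \<tau>) *\<^sub>R v - grad_v \<phi> (u, v) + (2 * Lvv) *\<^sub>R w + 2 *\<^sub>R grad_v \<phi> (u', w)"
    using \<eta> \<tau>_pos Lvv_pos by (simp add: y_def scaleR_add_right scaleR_diff_right)
  moreover have "samgda_inner g \<phi> \<tau> Lvv u v u' (Suc j) = prox (\<lambda>z. ereal \<eta> * g z) y"
    by (simp add: Let_def \<eta>_def[symmetric] w_def[symmetric] y_def)
  moreover have "(1 / \<eta>) *\<^sub>R y - (1 / \<eta>) *\<^sub>R prox (\<lambda>z. ereal \<eta> * g z) y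
      \<in> subdiff g (prox (\<lambda>z. ereal \<eta> * g z) y)"
    using prox_scale_eq_iff[OF g_cpc bounded_effdom_g \<eta>] by blast
  ultimately show ?thesis by (simp only: \<eta>_inv w_def)
qed

text \<open>Both the new iterate and \<open>q\<close> are values of the resolvent of \<open>\<partial>g\<close> with \<open>\<alpha> = 1/\<tau> + 2 L\<^sub>v\<^sub>v\<close>, at
  arguments that differ by \<open>2 L\<^sub>v\<^sub>v (w - q) + 2 (\<nabla>\<^sub>v\<phi>(u', w) - \<nabla>\<^sub>v\<phi>(u', q))\<close>.\<close>

lemma inner_contraction:
  assumes q: "((1 / \<tau>) *\<^sub>R v - grad_v \<phi> (u, v) + 2 *\<^sub>R grad_v \<phi> (u', q)) - (1 / \<tau>) *\<^sub>R q \<in> subdiff g q"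
  shows "norm (samgda_inner g \<phi> \<tau> Lvv u v u' (Suc j) - q)
    \<le> 4 * Lvv / (1 / \<tau> + 2 * Lvv) * norm (samgda_inner g \<phi> \<tau> Lvv u v u' j - q)"
proof -
  define w where "w = samgda_inner g \<phi> \<tau> Lvv u v u' j"
  define b where "b = (1 / \<tau>) *\<^sub>R v - grad_v \<phi> (u, v)"
  have "(b + (2 * Lvv) *\<^sub>R q + 2 *\<^sub>R grad_v \<phi> (u', q)) - (1 / \<tau> + 2 * Lvv) *\<^sub>R q =
      (b + 2 *\<^sub>R grad_v \<phi> (u', q)) - (1 / \<tau>) *\<^sub>R q"
    by (simp add: scaleR_add_left)
  with q have "(b + (2 * Lvv) *\<^sub>R q + 2 *\<^sub>R grad_v \<phi> (u', q)) - (1 / \<tau> + 2 * Lvv) *\<^sub>R q \<in> subdiff g q"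
    by (simp only: b_def)
  from resolvent_lipschitz[OF g_proper inner_step_mem[of v u u' j, folded w_def b_def] this]
  have "(1 / \<tau> + 2 * Lvv) * norm (samgda_inner g \<phi> \<tau> Lvv u v u' (Suc j) - q)
      \<le> norm ((2 * Lvv) *\<^sub>R (w - q) + 2 *\<^sub>R (grad_v \<phi> (u', w) - grad_v \<phi> (u', q)))"
    by (simp only: scaleR_diff_right add_diff_add add.assoc diff_self add_0)
  also have "\<dots> \<le> norm ((2 * Lvv) *\<^sub>R (w - q)) + norm (2 *\<^sub>R (grad_v \<phi> (u', w) - grad_v \<phi> (u', q)))"
    by (rule norm_triangle_ineq)
  also have "\<dots> \<le> 4 * Lvv * norm (w - q)"
    using grad_v_lipschitz_Lvv[of u' w q] Lvv_pos by simp
  finally show ?thesis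
    using \<tau>_pos Lvv_pos by (simp add: w_def pos_le_divide_eq add_pos_pos mult.commute)
qed

text \<open>The contraction ratio of the inner loop is \<open>1 - 2 rate\<close>.\<close>

definition "rate = (1 / \<tau> - 2 * Lvv) / (2 * (1 / \<tau> + 2 * Lvv))"

lemma rate_less_half: "rate < 1 / 2"
  using \<tau>_pos Lvv_pos by (simp add: rate_def divide_less_eq add_pos_pos)

lemma contraction_ratio_eq: "4 * Lvv / (1 / \<tau> + 2 * Lvv) = 1 - 2 * rate"
proof -
  have *: "1 - 2 * (N / (2 * D)) = (D - N) / D" if "D \<noteq> 0" for N D :: real
    using that by (simp add: diff_divide_distrib)
  have "0 < 1 / \<tau> + 2 * Lvv"
    using \<tau>_pos Lvv_pos by (intro add_pos_pos) simp_all
  then have "1 / \<tau> + 2 * Lvv \<noteq> 0" by (rule less_imp_neq[symmetric])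
  from *[OF this, of "1 / \<tau> - 2 * Lvv"] show ?thesis
    unfolding rate_def by simp
qed

text \<open>The estimate \<open>1 - 2 rate \<le> exp(- 2 rate)\<close> is iterated from an arbitrary inner iterate \<open>j\<close>,
  because the starting point of the inner loop may lie outside the domain of \<open>g\<close>, whereas all later
  iterates lie in it.\<close>

lemma inner_geometric:
  assumes q: "((1 / \<tau>) *\<^sub>R v - grad_v \<phi> (u, v) + 2 *\<^sub>R grad_v \<phi> (u', q)) - (1 / \<tau>) *\<^sub>R q \<in> subdiff g q"
  shows "norm (samgda_inner g \<phi> \<tau> Lvv u v u' (j + n) - q)
    \<le> exp (- (2 * rate * real n)) * norm (samgda_inner g \<phi> \<tau> Lvv u v u' j - q)"
proof (induction n)
  case (Suc n)
  have "4 * Lvv / (1 / \<tau> + 2 * Lvv) \<le> exp (- (2 * rate))"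
    using exp_ge_add_one_self[of "- (2 * rate)"] by (simp add: contraction_ratio_eq)
  then have "norm (samgda_inner g \<phi> \<tau> Lvv u v u' (Suc (j + n)) - q)
      \<le> exp (- (2 * rate)) * norm (samgda_inner g \<phi> \<tau> Lvv u v u' (j + n) - q)"
    by (intro order_trans[OF inner_contraction[OF q]] mult_right_mono) auto
  also have "\<dots> \<le> exp (- (2 * rate)) *
      (exp (- (2 * rate * real n)) * norm (samgda_inner g \<phi> \<tau> Lvv u v u' j - q))"
    by (intro mult_left_mono Suc.IH) simp
  also have "\<dots> = exp (- (2 * rate * real (Suc n))) * norm (samgda_inner g \<phi> \<tau> Lvv u v u' j - q)"
    by (simp add: exp_add[symmetric] mult.assoc[symmetric] distrib_left add.commute)
  finally show ?case by simp
qed simp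

lemma inner_mem_effdom:
  assumes "1 \<le> J"
  shows "samgda_inner g \<phi> \<tau> Lvv u v u' J \<in> effdom g"
proof -
  obtain j where "J = Suc j" using assms by (cases J) auto
  then show ?thesis using subdiff_imp_effdom[OF g_proper inner_step_mem] by blast
qed

abbreviation (input) "step J \<equiv> samgda_step f g \<phi> \<tau> Lvv J"

text \<open>The proximal step in \<open>u\<close> is exact, so a step of the method differs from the resolvent in
  the \<open>v\<close>-block only, by the error of the inner loop.\<close>

lemma step_eq:
  "step J x = (fst (R x), samgda_inner g \<phi> \<tau> Lvv (fst x) (snd x) (fst (R x)) J)"
proof -
  have "((1 / \<tau>) *\<^sub>R fst x - grad_u \<phi> x) - (1 / \<tau>) *\<^sub>R fst (R x) \<in> subdiff f (fst (R x))"
    using h_resolvent_mem[of x] gradient_diff_mem_saddle_op_iff[of x "fst (R x)" "snd (R x)"] by simp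
  then have "prox (\<lambda>z. ereal \<tau> * f z) (fst x - \<tau> *\<^sub>R grad_u \<phi> x) = fst (R x)"
    using \<tau>_pos
    by (simp add: prox_scale_eq_iff[OF f_cpc bounded_effdom_f] scaleR_diff_right)
  then show ?thesis by (cases x) (simp add: samgda_step_def Let_def)
qed

lemma implicit_v_resolvent:
  "((1 / \<tau>) *\<^sub>R snd x - grad_v \<phi> (fst x, snd x) + 2 *\<^sub>R grad_v \<phi> (fst (R x), snd (R x)))
    - (1 / \<tau>) *\<^sub>R snd (R x) \<in> subdiff g (snd (R x))"
  using h_resolvent_mem[of x] gradient_diff_mem_saddle_op_iff[of x "fst (R x)" "snd (R x)"] by simp

lemma norm_step_error:
  "norm (step J x - R x) =
   norm (samgda_inner g \<phi> \<tau> Lvv (fst x) (snd x) (fst (R x)) J - snd (R x))"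
  by (cases "R x") (simp add: step_eq norm_Pair)

lemma step_effdom:
  assumes "1 \<le> J"
  shows "fst (step J x) \<in> effdom f" "snd (step J x) \<in> effdom g"
  using h_resolvent_effdom inner_mem_effdom[OF assms] by (simp_all add: step_eq)

lemma step_error_le_diameter:
  assumes "1 \<le> J"
  shows "norm (step J x - R x) \<le> \<Omega>"
  by (intro norm_diff_le_diameter step_effdom assms h_resolvent_effdom)

text \<open>A negative rate is harmless, because the error never exceeds the diameter. For a positive
  one, half of the geometric decay suffices.\<close>

lemma step_error_warm:
  assumes J: "1 \<le> J" and v: "snd x \<in> effdom g"
  shows "norm (step J x - R x) \<le> \<Omega> * exp (- rate * real J)"
proof (cases "0 \<le> rate")
  case True
  have "norm (step J x - R x) \<le> exp (- (2 * rate * real J)) * norm (snd x - snd (R x))"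
    using inner_geometric[OF implicit_v_resolvent[of x], of 0 J] by (simp add: norm_step_error)
  also have "\<dots> \<le> exp (- rate * real J) * \<Omega>"
    using True by (intro mult_mono norm_diff_le_diameter_g v h_resolvent_effdom) auto
  finally show ?thesis by (simp add: mult.commute)
next
  case False
  then have "- rate * real J \<ge> 0" by (intro mult_nonneg_nonneg) auto
  then have "\<Omega> * 1 \<le> \<Omega> * exp (- rate * real J)"
    using diameter_nonneg by (intro mult_left_mono) (simp_all only: one_le_exp_iff)
  then show ?thesis using step_error_le_diameter[OF J, of x] by simp
qed

text \<open>If \<open>x\<close> lies outside the domain, the diameter bounds the error only from the first inner
  iterate on. For a nonnegative rate the error is then at most \<open>\<Omega>\<close> times
  \<open>exp(- 2 rate (J - 1)) = exp(- rate (J - 2)) exp(- rate J)\<close>, and since \<open>J \<ge> 1\<close> the first factor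
  is at most \<open>exp(rate) \<le> exp(1/2) \<le> 2\<close>.\<close>

lemma step_error_cold:
  assumes J: "1 \<le> J"
  shows "norm (step J x - R x) \<le> 2 * (\<Omega> * exp (- rate * real J))"
proof (cases "0 \<le> rate")
  case True
  let ?w = "samgda_inner g \<phi> \<tau> Lvv (fst x) (snd x) (fst (R x))"
  have "norm (step J x - R x) \<le> exp (- (2 * rate * real (J - 1))) * norm (?w 1 - snd (R x))"
    using inner_geometric[OF implicit_v_resolvent[of x], of 1 "J - 1"] J by (simp add: norm_step_error)
  also have "\<dots> \<le> exp (1 / 2 + - rate * real J) * \<Omega>"
  proof (intro mult_mono norm_diff_le_diameter_g h_resolvent_effdom inner_mem_effdom)
    have "0 \<le> rate * (real J - 1)" using True J by (intro mult_nonneg_nonneg) auto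
    then have "- (2 * rate * real (J - 1)) \<le> 1 / 2 + - rate * real J"
      using rate_less_half J by (simp add: of_nat_diff algebra_simps)
    then show "exp (- (2 * rate * real (J - 1))) \<le> exp (1 / 2 + - rate * real J)" by simp
  qed auto
  also have "\<dots> \<le> (2 * exp (- rate * real J)) * \<Omega>"
    unfolding exp_add using diameter_nonneg
    by (intro mult_right_mono exp_half_le2) auto
  finally show ?thesis by (simp add: mult_ac)
next
  case False
  then have "- rate * real J \<ge> 0" by (intro mult_nonneg_nonneg) auto
  then have "\<Omega> * 1 \<le> \<Omega> * exp (- rate * real J)"
    using diameter_nonneg by (intro mult_left_mono) (simp_all only: one_le_exp_iff)
  then show ?thesis using step_error_le_diameter[OF J, of x] diameter_nonneg by simp
qed

section \<open>Summation over the outer iterations\<close>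

abbreviation (input) "iter J x0 \<equiv> samgda f g \<phi> \<tau> Lvv J x0"
abbreviation (input) "err J \<equiv> 3 / 2 * \<beta> * \<Omega>\<^sup>2 * exp (- rate * real J)"

lemma err_nonneg: "0 \<le> err J"
  using \<beta>_pos by (intro mult_nonneg_nonneg) auto

lemma bregman_step_le:
  assumes J: "1 \<le> J" and xs: "xs \<in> wmvi_zeros \<rho> M"
    and e: "norm (step J x - R x) \<le> c * (\<Omega> * exp (- rate * real J))"
  shows "bregman h xs (step J x) \<le> bregman h xs (R x) + c * err J"
proof -
  have "0 \<in> M xs" using xs by (simp add: wmvi_zeros_def zeros_def)
  then have "norm (xs - R x) \<le> \<Omega>"
    by (intro norm_diff_le_diameter saddle_op_effdom h_resolvent_effdom)
  then have "bregman h xs (step J x) \<le> bregman h xs (R x) + 3 / 2 * \<beta> * \<Omega> * norm (step J x - R x)"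
    by (intro bregman_perturb step_error_le_diameter J)
  also have "3 / 2 * \<beta> * \<Omega> * norm (step J x - R x) \<le> 3 / 2 * \<beta> * \<Omega> * (c * (\<Omega> * exp (- rate * real J)))"
    using \<beta>_pos diameter_nonneg by (intro mult_left_mono e) auto
  finally show ?thesis by (simp add: power2_eq_square mult_ac)
qed

text \<open>The sum ends with \<open>D_h(x\<^sub>*, R x\<^sub>n)\<close>, before the error of the last step enters. The
  \<open>n + 1\<close> summands therefore carry only \<open>n\<close> errors, which leaves room for the first error to be
  twice as large as the others.\<close>

lemma fejer_sum:
  assumes J: "1 \<le> J" and xs: "xs \<in> wmvi_zeros \<rho> M" and \<rho>: "0 \<le> \<rho>"
  shows "(1 - \<rho> * \<beta>) * (\<Sum>i\<le>n. bregman h (R (iter J x0 i)) (iter J x0 i)) + bregman h xs (R (iter J x0 n))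
    \<le> bregman h xs x0 + (if n = 0 then 0 else real (Suc n)) * err J"
proof (induction n)
  case 0
  then show ?case using resolvent_fejer[OF xs \<rho>, of x0] by simp
next
  case (Suc n)
  let ?x = "iter J x0"
  define E where "E = err J"
  have step: "bregman h xs (?x (Suc n)) \<le> bregman h xs (R (?x n)) + (if n = 0 then 2 else 1) * E"
  proof (cases n)
    case 0
    then show ?thesis
      using bregman_step_le[OF J xs step_error_cold[OF J], of x0, folded E_def] by simp
  next
    case (Suc m)
    then have "snd (?x n) \<in> effdom g" using step_effdom[OF J] by simp
    then have "norm (step J (?x n) - R (?x n)) \<le> 1 * (\<Omega> * exp (- rate * real J))"
      using step_error_warm[OF J] by (simp only: mult_1)
    from bregman_step_le[OF J xs this, folded E_def] show ?thesis
      by (simp add: Suc)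
  qed
  have "(1 - \<rho> * \<beta>) * (\<Sum>i\<le>Suc n. bregman h (R (?x i)) (?x i)) + bregman h xs (R (?x (Suc n)))
      \<le> (1 - \<rho> * \<beta>) * (\<Sum>i\<le>n. bregman h (R (?x i)) (?x i)) + bregman h xs (?x (Suc n))"
    using resolvent_fejer[OF xs \<rho>, of "?x (Suc n)"]
    by (simp only: sum.atMost_Suc distrib_left)
  also have "\<dots> \<le> bregman h xs x0 + ((if n = 0 then 0 else real (Suc n)) * E + (if n = 0 then 2 else 1) * E)"
    using step Suc.IH[folded E_def] by linarith
  also have "\<dots> = bregman h xs x0 + (if Suc n = 0 then 0 else real (Suc (Suc n))) * E"
    by (cases "n = 0") (simp_all add: algebra_simps)
  finally show ?case unfolding E_def .
qed

end

section \<open>The convergence rate\<close>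

theorem theorem5p4:
  fixes f :: "'a::euclidean_space \<Rightarrow> ereal"
    and g :: "'b::euclidean_space \<Rightarrow> ereal"
    and \<phi> :: "'a \<times> 'b \<Rightarrow> real"
    and Luu Luv Lvu Lvv L Lhat \<Omega> \<rho> \<tau> :: real
    and J k :: nat
    and x0 xs :: "'a \<times> 'b"
    and M :: "'a \<times> 'b \<Rightarrow> ('a \<times> 'b) set"
    and h :: "'a \<times> 'b \<Rightarrow> real"
    and R :: "'a \<times> 'b \<Rightarrow> 'a \<times> 'b"
    and x :: "nat \<Rightarrow> 'a \<times> 'b"
  defines "M \<equiv> saddle_op f g \<phi>"
    and "h \<equiv> kernel_h \<tau> \<phi>"
    and "R \<equiv> h_resolvent h M"
    and "x \<equiv> samgda f g \<phi> \<tau> Lvv J x0"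
    and "Lhat \<equiv> max Luu Lvv"
  assumes "composite_smooth f g \<phi> Luu Luv Lvu Lvv"
    and "L > 0" and "L-lipschitz_on UNIV (gradient \<phi>)"
    and "\<Omega> \<ge> 0" and "bounded_domain f g \<Omega>"
    and "0 \<le> \<rho>" and "\<rho> < 1 / (2 * L + Lhat)"
    and "weak_MVI \<rho> M"
    and "\<rho> / (1 - \<rho> * L) < \<tau>" and "\<tau> < 1 / (L + Lhat)"
    and "J \<ge> 1" and "k \<ge> 1"
    and "xs \<in> wmvi_zeros \<rho> M"
  shows "(MIN i\<in>{1..k}. LEAST r. \<exists>s\<in>M (R (x (i - 1))). r = (norm s)\<^sup>2 / (2 * (1 / \<tau> + L)))
           \<le> (MIN i\<in>{1..k}. bregman h (R (x (i - 1))) (x (i - 1)))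
       \<and> (MIN i\<in>{1..k}. bregman h (R (x (i - 1))) (x (i - 1)))
           \<le> bregman h xs x0 / ((1 - \<rho> * (1 / \<tau> + L)) * real k)
             + 3 * \<Omega>\<^sup>2 * (1 / \<tau> + L) / (2 * (1 - \<rho> * (1 / \<tau> + L)))
               * exp (- ((1 / \<tau> - 2 * Lvv) / (2 * (1 / \<tau> + 2 * Lvv))) * real J)"
proof -
  have Luu: "0 < Luu" and Lvv: "0 < Lvv"
    using assms(6) by (auto simp: composite_smooth_def)
  have Lhat: "0 < Lhat" using Luu by (simp add: assms(5))
  have "\<rho> * (2 * L + Lhat) < 1"
    using assms(12) \<open>L > 0\<close> Lhat by (simp add: pos_less_divide_eq)
  moreover have "\<rho> * (2 * L + Lhat) = \<rho> * L + \<rho> * (L + Lhat)"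
    by (simp add: algebra_simps)
  moreover have "0 \<le> \<rho> * (L + Lhat)"
    using \<open>0 \<le> \<rho>\<close> \<open>L > 0\<close> Lhat by simp
  ultimately have \<rho>L: "\<rho> * L < 1" by linarith
  then have "0 \<le> \<rho> / (1 - \<rho> * L)" using \<open>0 \<le> \<rho>\<close> by simp
  then have \<tau>: "0 < \<tau>" using assms(14) by linarith
  have "L + Lhat < 1 / \<tau>"
    using assms(15) \<tau> \<open>L > 0\<close> Lhat by (simp add: field_simps)
  then have "L + Lvv < 1 / \<tau>" by (simp add: assms(5))
  then interpret composite_saddle f g \<phi> Luu Luv Lvu Lvv L \<Omega> \<tau>
    by unfold_locales (use assms \<tau> in auto)
  define \<delta> where "\<delta> = 1 - \<rho> * (1 / \<tau> + L)"
  define D where "D = (\<lambda>i. bregman h (R (x i)) (x i))"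
  define m where "m = (MIN i\<in>{1..k}. D (i - 1))"
  \<comment> \<open>The lower end of the step-size range is the condition \<open>\<rho> (1/\<tau> + L) < 1\<close>.\<close>
  have \<delta>: "0 < \<delta>"
    using assms(14) \<rho>L \<tau> by (simp add: \<delta>_def field_simps)
  have lower: "(LEAST r. \<exists>s\<in>M (R (x i)). r = (norm s)\<^sup>2 / (2 * (1 / \<tau> + L))) \<le> D i" for i
  proof -
    have "(LEAST r. \<exists>s\<in>M (R (x i)). r = (norm s)\<^sup>2 / (2 * (1 / \<tau> + L)))
        \<le> (norm (gradient h (x i) - gradient h (R (x i))))\<^sup>2 / (2 * (1 / \<tau> + L))"
      unfolding assms(1-3) by (rule Least_norm_le[OF h_resolvent_mem]) (use \<beta>_pos in simp)
    also have "\<dots> \<le> D i"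
      unfolding D_def assms(1-3) by (rule norm_residual_le_bregman)
    finally show ?thesis .
  qed
  have "(MIN i\<in>{1..k}. LEAST r. \<exists>s\<in>M (R (x (i - 1))). r = (norm s)\<^sup>2 / (2 * (1 / \<tau> + L))) \<le> m"
    unfolding m_def
  proof (rule Min.boundedI)
    fix d assume "d \<in> (\<lambda>i. D (i - 1)) ` {1..k}"
    then obtain i where i: "i \<in> {1..k}" "d = D (i - 1)" by blast
    then show "(MIN i\<in>{1..k}. LEAST r. \<exists>s\<in>M (R (x (i - 1))). r = (norm s)\<^sup>2 / (2 * (1 / \<tau> + L))) \<le> d"
      by (intro order_trans[OF Min_le lower[of "i - 1", folded i(2)]]) auto
  qed (use \<open>k \<ge> 1\<close> in auto)
  moreover have "m \<le> bregman h xs x0 / (\<delta> * real k)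
      + 3 * \<Omega>\<^sup>2 * (1 / \<tau> + L) / (2 * \<delta>) * exp (- rate * real J)"
  proof -
    obtain n where n: "k = Suc n" using \<open>k \<ge> 1\<close> by (cases k) auto
    define E where "E = err J"
    have "m \<le> D i" if "i \<le> n" for i
      unfolding m_def using that n by (intro Min_le) (auto intro!: image_eqI[of _ _ "Suc i"])
    then have "(\<Sum>i\<le>n. m) \<le> (\<Sum>i\<le>n. D i)" by (intro sum_mono) simp
    then have "\<delta> * (real k * m) \<le> \<delta> * (\<Sum>i\<le>n. D i)"
      using \<delta> by (intro mult_left_mono) (simp_all add: n)
    also have "\<dots> \<le> bregman h xs x0 + real k * E"
    proof -
      have "\<delta> * (\<Sum>i\<le>n. D i) + bregman h xs (R (x n)) \<le> bregman h xs x0 + (if n = 0 then 0 else real (Suc n)) * E"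
        using fejer_sum[OF \<open>J \<ge> 1\<close> _ \<open>0 \<le> \<rho>\<close>, of xs x0 n] assms(18)
        unfolding \<delta>_def D_def E_def assms(1-4) by simp
      moreover have "0 \<le> bregman h xs (R (x n))"
        unfolding assms(2) by (rule bregman_h_nonneg)
      moreover have "(if n = 0 then 0 else real (Suc n)) * E \<le> real k * E"
        using err_nonneg[of J] by (intro mult_right_mono) (auto simp: n E_def)
      ultimately show ?thesis by linarith
    qed
    finally have "m \<le> (bregman h xs x0 + real k * E) / (\<delta> * real k)"
      using \<delta> n by (simp add: pos_le_divide_eq mult_ac)
    also have "\<dots> = bregman h xs x0 / (\<delta> * real k) + E / \<delta>"
      using n by (simp add: add_divide_distrib)
    also have "E / \<delta> = 3 * \<Omega>\<^sup>2 * (1 / \<tau> + L) / (2 * \<delta>) * exp (- rate * real J)"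
      by (simp add: E_def)
    finally show ?thesis .
  qed
  ultimately show ?thesis
    unfolding m_def D_def \<delta>_def rate_def by blast
qed

end
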